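(* Let $k$ be an odd positive integer. Then there exist infinitely many integers $r$ such that $\mathrm{bal}_r(n,P_{rk})=\Omega(n^2)$ (as $n\to\infty$). In particular, $\mathrm{bal}_7(n,P_{7k})=\Omega(n^2)$.
   Context: $P_m$ denotes the path with $m$ edges. An $r$-edge-colored graph $G$ is balanced if each of the $r$ colors appears on either $\lfloor e(G)/r\rfloor$ or $\lceil e(G)/r\rceil$ edges. For a graph $G$, $\mathrm{bal}_r(n,G)$ is the minimum integer $m$ (if it exists) such that every $r$-edge-coloring of $K_n$ with more than $m$ edges in each of the $r$ colors contains a balanced copy of $G$ (a subgraph isomorphic to $G$ whose inherited coloring is balanced); if no such $m$ exists, $\mathrm{bal}_r(n,G)=\infty$. *)

theory Defs
  imports Complex_Main "HOL-Library.Ramsey" "HOL-Library.Extended_Real"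
    "HOL-Library.Landau_Symbols"
begin

text \<open>A graph is a vertex set together with a set of two-element subsets of it.\<close>

type_synonym 'a graph = "'a set \<times> 'a set set"

abbreviation verts :: "'a graph \<Rightarrow> 'a set" where "verts \<equiv> fst"
abbreviation edges :: "'a graph \<Rightarrow> 'a set set" where "edges \<equiv> snd"

definition simple_graph :: "'a graph \<Rightarrow> bool" where
  "simple_graph G \<longleftrightarrow> finite (verts G) \<and> edges G \<subseteq> [verts G]\<^bsup>2\<^esup>"

definition subgraph :: "'a graph \<Rightarrow> 'a graph \<Rightarrow> bool" where
  "subgraph H G \<longleftrightarrow> simple_graph H \<and> verts H \<subseteq> verts G \<and> edges H \<subseteq> edges G"

definition graph_isomorphic :: "'a graph \<Rightarrow> 'b graph \<Rightarrow> bool" where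
  "graph_isomorphic G H \<longleftrightarrow>
     (\<exists>f. bij_betw f (verts G) (verts H) \<and> (\<lambda>e. f ` e) ` edges G = edges H)"

definition complete_graph :: "nat \<Rightarrow> nat graph" where
  "complete_graph n = ({..<n}, [{..<n}]\<^bsup>2\<^esup>)"

text \<open>The path is indexed by its number of edges, not of vertices.\<close>

definition path_graph :: "nat \<Rightarrow> nat graph" where
  "path_graph m = ({..m}, {{i, Suc i} |i. i < m})"

text \<open>Colours are the numbers below \<open>r\<close>; only the values of a colouring on edges matter.\<close>

definition edge_coloring :: "nat \<Rightarrow> 'a graph \<Rightarrow> ('a set \<Rightarrow> nat) \<Rightarrow> bool" where
  "edge_coloring r G c \<longleftrightarrow> c \<in> edges G \<rightarrow> {..<r}"

definition color_class :: "'a graph \<Rightarrow> ('a set \<Rightarrow> nat) \<Rightarrow> nat \<Rightarrow> 'a set set" where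
  "color_class G c i = {e \<in> edges G. c e = i}"

definition balanced :: "nat \<Rightarrow> 'a graph \<Rightarrow> ('a set \<Rightarrow> nat) \<Rightarrow> bool" where
  "balanced r G c \<longleftrightarrow>
     (\<forall>i<r. int (card (color_class G c i)) = \<lfloor>real (card (edges G)) / real r\<rfloor> \<or>
            int (card (color_class G c i)) = \<lceil>real (card (edges G)) / real r\<rceil>)"

definition has_balanced_copy ::
  "nat \<Rightarrow> 'a graph \<Rightarrow> ('a set \<Rightarrow> nat) \<Rightarrow> 'b graph \<Rightarrow> bool" where
  "has_balanced_copy r K c G \<longleftrightarrow>
     (\<exists>H. subgraph H K \<and> graph_isomorphic G H \<and> balanced r H c)"

text \<open>The infimum in \<^typ>\<open>enat\<close> is the minimum of a nonempty set, and \<open>\<infinity>\<close> for the empty one.\<close>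

definition bal :: "nat \<Rightarrow> nat \<Rightarrow> 'b graph \<Rightarrow> enat" where
  "bal r n G = Inf (enat ` {m. \<forall>c. edge_coloring r (complete_graph n) c \<longrightarrow>
       (\<forall>i<r. m < card (color_class (complete_graph n) c i)) \<longrightarrow>
       has_balanced_copy r (complete_graph n) c G})"

text \<open>The asymptotic lower bound \<open>f = \<Omega>(g)\<close> for a function that may take the value \<open>\<infinity>\<close>,
  which the library's Landau symbols do not cover.\<close>

definition enat_bigomega :: "(nat \<Rightarrow> enat) \<Rightarrow> (nat \<Rightarrow> real) \<Rightarrow> bool" where
  "enat_bigomega f g \<longleftrightarrow>
     (\<exists>C>0. \<forall>\<^sub>F n in sequentially. ereal (C * \<bar>g n\<bar>) \<le> ereal_of_enat (f n))"

lemma enat_bigomega_iff_bigomega: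
  "enat_bigomega (\<lambda>n. enat (f n)) g \<longleftrightarrow> (\<lambda>n. real (f n)) \<in> \<Omega>(g)"
  by (simp add: enat_bigomega_def bigomega_def)

lemma simple_graph_complete_graph: "simple_graph (complete_graph n)"
  by (simp add: simple_graph_def complete_graph_def)

lemma simple_graph_path_graph: "simple_graph (path_graph m)"
  by (auto simp: simple_graph_def path_graph_def nsets_def)

lemma card_edges_path_graph: "card (edges (path_graph m)) = m"
proof -
  have "edges (path_graph m) = (\<lambda>i. {i, Suc i}) ` {..<m}"
    by (auto simp: path_graph_def)
  moreover have "inj_on (\<lambda>i. {i, Suc i}) {..<m}"
    by (auto simp: inj_on_def doubleton_eq_iff)
  ultimately show ?thesis by (simp add: card_image)
qed

end

theory Submission
  imports Defs
begin

text \<open>Split the vertices of \<open>K\<^sub>n\<close> evenly into \<open>t\<close> parts, with \<open>t \<ge> 4\<close> even. Give each of the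
  \<open>t choose 2\<close> pairs of parts its own colour and use one further colour inside the parts, so that
  every colour class has quadratic size. In a balanced path of \<open>r * k\<close> edges every colour occurs
  exactly \<open>k\<close> times, so exactly \<open>(t - 1) * k\<close> edges leave a given part. This number is odd, hence
  each part contains exactly one endpoint of the path; but there are more than two parts.\<close>

text \<open>The parts are the residue classes mod \<open>t\<close>, so any \<open>t\<close>
  consecutive vertices meet every part once. The set \<open>p\<close> of parts met by an edge has
  two elements exactly when the edge crosses between parts; \<open>h\<close> numbers such pairs from
  0, and \<open>t choose 2\<close> is the next free colour.\<close>

definition parts_coloring :: "nat \<Rightarrow> (nat set \<Rightarrow> nat) \<Rightarrow> nat set \<Rightarrow> nat" where
  "parts_coloring t h e =
     (let p = (\<lambda>v. v mod t) ` e in if card p = 2 then h p else t choose 2)"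

text \<open>Each switch flips the truth value of \<open>P\<close>, so the parity of their number
  only remembers whether the two ends agree. It will be applied to membership in one part along the
  path.\<close>

lemma odd_card_switches_iff:
  fixes P :: "nat \<Rightarrow> bool"
  shows "odd (card {i. i < m \<and> P i \<noteq> P (Suc i)}) \<longleftrightarrow> P 0 \<noteq> P m"
proof (induction m)
  case 0
  then show ?case by simp
next
  case (Suc m)
  define A where "A = {i. i < m \<and> P i \<noteq> P (Suc i)}"
  have A: "finite A" "m \<notin> A" by (simp_all add: A_def)
  have IH: "odd (card A) \<longleftrightarrow> P 0 \<noteq> P m" using Suc by (simp only: A_def)
  have step: "{i. i < Suc m \<and> P i \<noteq> P (Suc i)} = (if P m \<noteq> P (Suc m) then insert m A else A)"
    by (auto simp: A_def less_Suc_eq)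
  show ?case unfolding step using A IH by auto
qed

text \<open>Cut the vertices into blocks of length \<open>q\<close>. Joining position
  \<open>a\<close> of one of the first \<open>m\<close> blocks to position \<open>b\<close> of one
  of the next \<open>m\<close> blocks gives \<open>m * m\<close> distinct edges of colour
  \<open>i\<close>. The case \<open>a = b\<close> is allowed, as it serves the colour used inside
  the parts.\<close>

lemma card_color_class_ge:
  assumes "a < q" "b < q"
    and col: "\<And>x y. x < y \<Longrightarrow> c {q * x + a, q * y + b} = i"
  shows "(n div (2 * q))\<^sup>2 \<le> card (color_class (complete_graph n) c i)"
proof -
  define m where "m = n div (2 * q)"
  define g where "g = (\<lambda>(x, y). {q * x + a, q * y + b})"
  have less: "q * x + a < q * y + b" if "x < y" for x y
  proof -
    have "q * x + a < q * Suc x" using assms by simp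
    also have "\<dots> \<le> q * y" using that by (intro mult_le_mono2) simp
    finally show ?thesis by simp
  qed
  have div: "(q * x + a) div q = x" "(q * x + b) div q = x" for x
    using assms by simp_all
  have "inj_on g ({..<m} \<times> {m..<2 * m})"
  proof (rule inj_onI)
    fix z z' assume zz': "z \<in> {..<m} \<times> {m..<2 * m}" "z' \<in> {..<m} \<times> {m..<2 * m}"
      and "g z = g z'"
    \<comment> \<open>Division by \<open>q\<close> recovers the two block indices as an unordered
      pair; since one is below \<open>m\<close> and the other is not, their order is recovered
      too.\<close>
    then have "(\<lambda>v. v div q) ` g z = (\<lambda>v. v div q) ` g z'" by simp
    then have "{fst z, snd z} = {fst z', snd z'}" by (simp add: g_def div case_prod_unfold)
    with zz' show "z = z'" by (auto simp: doubleton_eq_iff)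
  qed
  moreover have "g ` ({..<m} \<times> {m..<2 * m}) \<subseteq> color_class (complete_graph n) c i"
  proof (rule image_subsetI)
    fix z assume "z \<in> {..<m} \<times> {m..<2 * m}"
    then obtain x y where z: "z = (x, y)" and xy: "x < m" "m \<le> y" "y < 2 * m" by auto
    then have "x < y" by simp
    have "q * y + b < q * Suc y" using assms by simp
    also have "\<dots> \<le> q * (2 * m)" using xy by (intro mult_le_mono2) simp
    also have "\<dots> = 2 * q * (n div (2 * q))" by (simp add: m_def)
    also have "\<dots> \<le> n" by (rule times_div_less_eq_dividend)
    finally have "q * y + b < n" .
    with less[OF \<open>x < y\<close>] show "g z \<in> color_class (complete_graph n) c i"
      by (auto simp: z g_def color_class_def complete_graph_def col[OF \<open>x < y\<close>] nsets_def)
  qed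
  moreover have "finite (color_class (complete_graph n) c i)"
    by (auto simp: color_class_def complete_graph_def nsets_def)
  ultimately have "card ({..<m} \<times> {m..<2 * m}) \<le> card (color_class (complete_graph n) c i)"
    by (metis card_image card_mono)
  then show ?thesis by (simp add: m_def power2_eq_square)
qed

text \<open>The quotient \<open>r * k / r\<close> is an integer, so floor and ceiling
  coincide.\<close>

lemma balanced_iff_card_color_class_eq:
  assumes "0 < r" "card (edges G) = r * k"
  shows "balanced r G c \<longleftrightarrow> (\<forall>i<r. card (color_class G c i) = k)"
  using assms by (simp add: balanced_def)

lemma no_balanced_path_parts_coloring:
  assumes h: "bij_betw h ([{..<t}]\<^bsup>2\<^esup>) {..<t choose 2}"
    and t: "even t" "2 < t" and k: "odd k"
  defines "r \<equiv> Suc (t choose 2)"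
  shows "\<not> has_balanced_copy r (complete_graph n) (parts_coloring t h) (path_graph (r * k))"
proof
  define l where "l = (\<lambda>v. v mod t)"
  define m where "m = r * k"
  define c where "c = parts_coloring t h"
  assume "has_balanced_copy r (complete_graph n) (parts_coloring t h) (path_graph (r * k))"
  then obtain H f where
    bij: "bij_betw f {..m} (verts H)"
    and img: "(\<lambda>e. f ` e) ` edges (path_graph m) = edges H"
    and bal: "balanced r H c"
    by (auto simp: has_balanced_copy_def graph_isomorphic_def m_def c_def path_graph_def)
  define E where "E = (\<lambda>i. {f i, f (Suc i)})"
  have "edges (path_graph m) = (\<lambda>i. {i, Suc i}) ` {..<m}" by (auto simp: path_graph_def)
  with img have edges: "edges H = E ` {..<m}" by (simp add: image_image E_def)
  have injf: "inj_on f {..m}" using bij by (simp add: bij_betw_def)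
  have injE: "inj_on E {..<m}"
  proof (rule inj_onI)
    fix i j assume "i \<in> {..<m}" "j \<in> {..<m}" "E i = E j"
    then have "f ` {i, Suc i} = f ` {j, Suc j}" "{i, Suc i} \<subseteq> {..m}" "{j, Suc j} \<subseteq> {..m}"
      by (auto simp: E_def)
    then have "{i, Suc i} = {j, Suc j}" using inj_on_image_eq_iff[OF injf] by blast
    then show "i = j" by (auto simp: doubleton_eq_iff)
  qed
  have "card (edges H) = r * k"
    using card_image[OF injE] by (simp add: edges m_def)
  then have cc: "card (color_class H c i) = k" if "i < r" for i
    using bal that balanced_iff_card_color_class_eq[of r H k c] by (simp add: r_def)
  have hlt: "h p < t choose 2" if "p \<in> [{..<t}]\<^bsup>2\<^esup>" for p
    using h that by (auto simp: bij_betw_def)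
  \<comment> \<open>Every part contains an end of the path; as there are only two ends, this will
    contradict \<open>2 < t\<close>.\<close>
  have "a = l (f 0) \<or> a = l (f m)" if a: "a < t" for a
  proof -
    define B where "B = {..<t} - {a}"
    have B: "{a, b} \<in> [{..<t}]\<^bsup>2\<^esup>" if "b \<in> B" for b
      using that a by (auto simp: B_def nsets_def)
    \<comment> \<open>For crossing edges the injectivity of \<open>h\<close> recovers the pair of
      parts from the colour; edges inside a part have colour \<open>t choose 2\<close>, which
      \<open>h\<close> never takes on pairs.\<close>
    have cclass: "color_class H c (h {a, b}) = {e \<in> edges H. l ` e = {a, b}}" if b: "b \<in> B" for b
    proof -
      have "c e = h {a, b} \<longleftrightarrow> l ` e = {a, b}" if "e \<in> edges H" for e
      proof (cases "card (l ` e) = 2")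
        case True
        then have "l ` e \<in> [{..<t}]\<^bsup>2\<^esup>"
          using t that by (auto simp: nsets_def l_def edges E_def)
        moreover have "c e = h (l ` e)" using True by (simp add: c_def parts_coloring_def l_def)
        ultimately show ?thesis using h B[OF b] by (metis bij_betw_def inj_on_eq_iff)
      next
        case False
        then have "c e = t choose 2" by (simp add: c_def parts_coloring_def l_def)
        moreover have "l ` e \<noteq> {a, b}" using False b by (auto simp: B_def)
        ultimately show ?thesis using hlt[OF B[OF b]] by simp
      qed
      then show ?thesis by (auto simp: color_class_def)
    qed
    have "card (\<Union>b\<in>B. color_class H c (h {a, b})) = (\<Sum>b\<in>B. card (color_class H c (h {a, b})))"
    proof (rule card_UN_disjoint)
      show "finite B" by (simp add: B_def)
      show "\<forall>b\<in>B. finite (color_class H c (h {a, b}))"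
        by (simp add: color_class_def edges)
      show "\<forall>b\<in>B. \<forall>b'\<in>B. b \<noteq> b' \<longrightarrow>
          color_class H c (h {a, b}) \<inter> color_class H c (h {a, b'}) = {}"
        by (auto simp: cclass doubleton_eq_iff)
    qed
    also have "\<dots> = (\<Sum>b\<in>B. k)"
      by (intro sum.cong refl cc) (use hlt B in \<open>auto simp: r_def less_Suc_eq\<close>)
    also have "\<dots> = (t - 1) * k" using a by (simp add: B_def)
    finally have "card (\<Union>b\<in>B. color_class H c (h {a, b})) = (t - 1) * k" .
    \<comment> \<open>The edges with one of these \<open>t - 1\<close> colours are those that leave
      part \<open>a\<close>, which are the places where the path enters or leaves it.\<close>
    moreover have "(\<Union>b\<in>B. color_class H c (h {a, b})) =
        E ` {i. i < m \<and> (l (f i) = a) \<noteq> (l (f (Suc i)) = a)}"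
    proof -
      have "(\<exists>b\<in>B. l ` E i = {a, b}) \<longleftrightarrow> (l (f i) = a) \<noteq> (l (f (Suc i)) = a)" for i
      proof -
        have "l v < t" for v using t by (simp add: l_def)
        then show ?thesis by (auto simp: E_def B_def doubleton_eq_iff)
      qed
      then have "E ` {i. i < m \<and> (l (f i) = a) \<noteq> (l (f (Suc i)) = a)} =
          E ` {i. i < m \<and> (\<exists>b\<in>B. l ` E i = {a, b})}" by simp
      also have "\<dots> = (\<Union>b\<in>B. {e \<in> E ` {..<m}. l ` e = {a, b}})" by blast
      also have "\<dots> = (\<Union>b\<in>B. color_class H c (h {a, b}))"
        by (intro SUP_cong refl) (simp add: cclass edges)
      finally show ?thesis by (rule sym)
    qed
    moreover have "inj_on E {i. i < m \<and> (l (f i) = a) \<noteq> (l (f (Suc i)) = a)}"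
      using injE by (rule inj_on_subset) auto
    ultimately have "card {i. i < m \<and> (l (f i) = a) \<noteq> (l (f (Suc i)) = a)} = (t - 1) * k"
      by (simp add: card_image)
    moreover have "odd ((t - 1) * k)" using t k by simp
    ultimately have "(l (f 0) = a) \<noteq> (l (f m) = a)"
      using odd_card_switches_iff[of m "\<lambda>i. l (f i) = a"] by simp
    then show ?thesis by auto
  qed
  then have "{..<t} \<subseteq> {l (f 0), l (f m)}" by auto
  then have "card {..<t} \<le> card {l (f 0), l (f m)}" by (intro card_mono) auto
  also have "\<dots> \<le> 2" by (simp add: card_insert_if)
  finally show False using t by simp
qed

lemma bal_path_graph_ge:
  assumes t: "even t" "2 < t" and k: "odd k"
  defines "r \<equiv> Suc (t choose 2)"
  shows "enat ((n div (2 * t))\<^sup>2) \<le> bal r n (path_graph (r * k))"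
proof -
  have "card ([{..<t}]\<^bsup>2\<^esup>) = t choose 2" "finite ([{..<t}]\<^bsup>2\<^esup>)"
    by (simp_all add: finite_imp_finite_nsets)
  then obtain h where h: "bij_betw h ([{..<t}]\<^bsup>2\<^esup>) {..<t choose 2}"
    using ex_bij_betw_finite_nat by (metis atLeast0LessThan)
  let ?c = "parts_coloring t h"
  have col: "edge_coloring r (complete_graph n) ?c"
  proof -
    have "?c e < r" for e
    proof (cases "card ((\<lambda>v. v mod t) ` e) = 2")
      case True
      then have "(\<lambda>v. v mod t) ` e \<in> [{..<t}]\<^bsup>2\<^esup>"
        using t by (auto simp: nsets_def intro: card_ge_0_finite)
      then have "h ((\<lambda>v. v mod t) ` e) < t choose 2"
        using h by (auto simp: bij_betw_def)
      with True show ?thesis by (simp add: parts_coloring_def r_def)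
    qed (simp add: parts_coloring_def r_def)
    then show ?thesis by (auto simp: edge_coloring_def)
  qed
  have large: "(n div (2 * t))\<^sup>2 \<le> card (color_class (complete_graph n) ?c i)" if "i < r" for i
  proof (cases "i < t choose 2")
    case True
    then obtain p where p: "p \<in> [{..<t}]\<^bsup>2\<^esup>" "h p = i"
      using h by (metis bij_betw_def imageE lessThan_iff)
    then obtain a b where ab: "p = {a, b}" "a \<noteq> b" "a < t" "b < t"
      by (auto simp: nsets_def card_2_iff)
    show ?thesis
      by (rule card_color_class_ge[OF ab(3,4)])
        (use ab p in \<open>simp add: parts_coloring_def\<close>)
  next
    case False
    \<comment> \<open>For the colour inside the parts, the edges within part 0 already
      suffice.\<close>
    then have "i = t choose 2" using that by (simp add: r_def)
    then show ?thesis
      using t by (intro card_color_class_ge[of 0 t 0]) (simp_all add: parts_coloring_def)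
  qed
  show ?thesis unfolding bal_def
  proof (intro Inf_greatest, clarify)
    fix m assume m: "\<forall>c. edge_coloring r (complete_graph n) c \<longrightarrow>
       (\<forall>i<r. m < card (color_class (complete_graph n) c i)) \<longrightarrow>
       has_balanced_copy r (complete_graph n) c (path_graph (r * k))"
    then obtain i where "i < r" "card (color_class (complete_graph n) ?c i) \<le> m"
      using col no_balanced_path_parts_coloring[OF h t k] unfolding r_def by (meson not_less)
    with large[of i] show "enat ((n div (2 * t))\<^sup>2) \<le> enat m" by simp
  qed
qed

lemma enat_bigomega_bal_path_graph:
  assumes t: "even t" "2 < t" and k: "odd k"
  defines "r \<equiv> Suc (t choose 2)"
  shows "enat_bigomega (\<lambda>n. bal r n (path_graph (r * k))) (\<lambda>n. real n ^ 2)"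
  unfolding enat_bigomega_def
proof (intro exI conjI)
  \<comment> \<open>With \<open>q = n div (2 * t)\<close> and \<open>n \<ge> 2 * t\<close> one has
    \<open>q \<ge> 1\<close>, hence \<open>n < 2 * t * (q + 1) \<le> 4 * t * q\<close>; squaring
    \<open>q \<ge> n / (4 * t)\<close> yields this constant.\<close>
  show "0 < (1 / (4 * real t))\<^sup>2" using t by simp
  show "\<forall>\<^sub>F n in sequentially. ereal ((1 / (4 * real t))\<^sup>2 * \<bar>real n ^ 2\<bar>) \<le>
      ereal_of_enat (bal r n (path_graph (r * k)))"
    using eventually_ge_at_top[of "2 * t"]
  proof eventually_elim
    case (elim n)
    define q where "q = n div (2 * t)"
    have "1 \<le> q" using elim t by (simp add: q_def div_greater_zero_iff Suc_le_eq)
    have "n < 2 * t * Suc q"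
      unfolding q_def using t by (intro dividend_less_times_div[of "2 * t" n, THEN less_le_trans]) auto
    also have "\<dots> \<le> 2 * t * (2 * q)" using \<open>1 \<le> q\<close> by (intro mult_le_mono2) simp
    finally have "n \<le> 4 * t * q" by simp
    then have "real n \<le> real (4 * t * q)" by (simp only: of_nat_le_iff)
    then have "1 / (4 * real t) * real n \<le> real q" using t by (simp add: field_simps)
    then have "(1 / (4 * real t) * real n)\<^sup>2 \<le> (real q)\<^sup>2" by (intro power_mono) auto
    then have "ereal ((1 / (4 * real t))\<^sup>2 * \<bar>real n ^ 2\<bar>) \<le> ereal_of_enat (enat (q\<^sup>2))"
      by (simp add: power_mult_distrib power_divide)
    also have "\<dots> \<le> ereal_of_enat (bal r n (path_graph (r * k)))"
      using bal_path_graph_ge[OF t k, of n] by (simp only: ereal_of_enat_le_iff q_def r_def)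
    finally show ?case .
  qed
qed

theorem theorem1p8:
  fixes k :: nat
  assumes "odd k"
  shows "infinite {r. 0 < r \<and> enat_bigomega (\<lambda>n. bal r n (path_graph (r * k))) (\<lambda>n. real n ^ 2)} \<and>
         enat_bigomega (\<lambda>n. bal 7 n (path_graph (7 * k))) (\<lambda>n. real n ^ 2)"
proof
  let ?R = "{r. 0 < r \<and> enat_bigomega (\<lambda>n. bal r n (path_graph (r * k))) (\<lambda>n. real n ^ 2)}"
  show "infinite ?R"
    unfolding infinite_nat_iff_unbounded
  proof
    fix s :: nat
    \<comment> \<open>An even number above 2 for every \<open>s\<close>, large enough that
      \<open>t choose 2\<close> exceeds \<open>s\<close>.\<close>
    define t where "t = 2 * s + 4"
    have "even t" "2 < t" by (simp_all add: t_def)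
    then have "Suc (t choose 2) \<in> ?R"
      using enat_bigomega_bal_path_graph[OF _ _ assms] by simp
    moreover have "s < Suc (t choose 2)"
    proof -
      have "t choose 2 = (s + 2) * (2 * s + 3)"
        by (simp add: t_def choose_two algebra_simps)
      then show ?thesis by simp
    qed
    ultimately show "\<exists>r>s. r \<in> ?R" by blast
  qed
  \<comment> \<open>Four parts have six pairs, which with the inner colour makes seven
    colours.\<close>
  show "enat_bigomega (\<lambda>n. bal 7 n (path_graph (7 * k))) (\<lambda>n. real n ^ 2)"
    using enat_bigomega_bal_path_graph[of 4, OF _ _ assms] by (simp add: choose_two)
qed

end
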